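(* Let $d\in\mathbb{N}$ with $d\equiv 0 \pmod 2$, let $\chi$ be a Dirichlet character with conductor $d$, and let $w_1,w_2\in\mathbb{N}$. Then for every $m\in\mathbb{Z}_+=\{0,1,2,\dots\}$, $$\sum_{i=0}^{m}\binom{m}{i}\frac{d^i}{i+1}\sum_{a=0}^{d-1}(-1)^{a-1}\chi(a)B_{i+1}\!\left(\frac{a+w_2x}{d}\right)T_{m-i,\chi}(dw_1-1)\,w_1^{i}w_2^{m-i} =\sum_{i=0}^{m}\binom{m}{i}\frac{d^i}{i+1}\sum_{a=0}^{d-1}(-1)^{a-1}\chi(a)B_{i+1}\!\left(\frac{a+w_1x}{d}\right)T_{m-i,\chi}(dw_2-1)\,w_2^{i}w_1^{m-i}.$$
   Context: $\chi$ is a primitive Dirichlet character modulo $d$ (with $\chi(l)=0$ when $\gcd(l,d)>1$). For $k,n\in\mathbb{Z}_+$, $T_{k,\chi}(n)=\sum_{l=0}^{n}(-1)^{l-1}\chi(l)l^k$. The Bernoulli polynomials $B_n(x)$ are defined by $\frac{t e^{xt}}{e^t-1}=\sum_{n=0}^{\infty}B_n(x)\frac{t^n}{n!}$. *)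

theory Defs
  imports
    Complex_Main
    "HOL-Number_Theory.Cong"
    "HOL-Computational_Algebra.Formal_Power_Series"
begin

definition dirichlet_character :: "nat \<Rightarrow> (int \<Rightarrow> complex) \<Rightarrow> bool" where
  "dirichlet_character d \<chi> \<longleftrightarrow>
     d > 0 \<and>
     (\<forall>a. \<chi> (a + int d) = \<chi> a) \<and>
     (\<forall>a b. \<chi> (a * b) = \<chi> a * \<chi> b) \<and>
     (\<forall>a. \<chi> a = 0 \<longleftrightarrow> \<not> coprime a (int d))"

definition induced_modulus :: "nat \<Rightarrow> (int \<Rightarrow> complex) \<Rightarrow> nat \<Rightarrow> bool" where
  "induced_modulus d \<chi> f \<longleftrightarrow>
     f > 0 \<and> f dvd d \<and>
     (\<forall>a. coprime a (int d) \<and> [a = 1] (mod int f) \<longrightarrow> \<chi> a = 1)"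

definition conductor :: "nat \<Rightarrow> (int \<Rightarrow> complex) \<Rightarrow> nat" where
  "conductor d \<chi> = (LEAST f. induced_modulus d \<chi> f)"

definition primitive_dirichlet_character :: "nat \<Rightarrow> (int \<Rightarrow> complex) \<Rightarrow> bool" where
  "primitive_dirichlet_character d \<chi> \<longleftrightarrow> dirichlet_character d \<chi> \<and> conductor d \<chi> = d"

text \<open>
  The exponential generating function \<open>t e\<^sup>x\<^sup>t / (e\<^sup>t - 1)\<close> is read as a formal power series
  in \<open>t\<close>. Numerator and denominator both have zero constant term, so the quotient
  is the one of \<^typ>\<open>complex fps\<close> that first cancels the common factor \<open>t\<close>.
\<close>

definition bernoulli_poly :: "nat \<Rightarrow> complex \<Rightarrow> complex" where
  "bernoulli_poly n x = fact n * fps_nth (fps_X * fps_exp x / (fps_exp 1 - 1)) n"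

lemma bernoulli_poly_egf:
  "Abs_fps (\<lambda>n. bernoulli_poly n x / fact n) * (fps_exp 1 - 1) = fps_X * fps_exp x"
proof -
  have nz: "fps_exp (1::complex) - 1 \<noteq> 0"
  proof
    assume "fps_exp (1::complex) - 1 = 0"
    then have "fps_nth (fps_exp (1::complex) - 1) 1 = 0" by simp
    then show False by simp
  qed
  have s1: "subdegree (fps_exp (1::complex) - 1) = 1" by (rule subdegreeI) auto
  have "subdegree (fps_X * fps_exp x) = 1" by (rule subdegreeI) auto
  then have "(fps_exp (1::complex) - 1) dvd fps_X * fps_exp x"
    using nz s1 by (subst fps_dvd_iff) auto
  moreover have "Abs_fps (\<lambda>n. bernoulli_poly n x / fact n) = fps_X * fps_exp x / (fps_exp 1 - 1)"
    by (rule fps_ext) (simp add: bernoulli_poly_def)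
  ultimately show ?thesis by simp
qed

text \<open>
  The exponent \<open>l - 1\<close> is an integer, equal to \<open>-1\<close> at \<open>l = 0\<close>, hence \<open>powi\<close>.
\<close>

definition alt_char_power_sum :: "nat \<Rightarrow> (int \<Rightarrow> complex) \<Rightarrow> nat \<Rightarrow> complex" where
  "alt_char_power_sum k \<chi> n =
     (\<Sum>l = 0..n. (- 1) powi (int l - 1) * \<chi> (int l) * of_nat l ^ k)"

end

theory Submission
  imports Defs
begin

text \<open>
  Put \<open>P(t) = (\<Sum>a<d. \<chi>(a) e\<^bsup>at\<^esup>)\<close>. As \<open>d\<close> is even, \<open>\<chi>\<close> vanishes at even arguments, so the
  signs are irrelevant; as \<open>\<chi>\<close> is primitive with \<open>d > 1\<close>, the values \<open>\<chi>(a)\<close> sum to \<open>0\<close>, which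
  removes the polar part caused by \<open>B\<^sub>0 = 1\<close>. Hence the left-hand side is \<open>m!\<close> times the
  coefficient of \<open>t\<^sup>m\<close> in
  \<open>e\<^bsup>w1 w2 x t\<^esup> P(w1 t) P(w2 t) (e\<^bsup>d w1 w2 t\<^esup> - 1) / ((e\<^bsup>d w1 t\<^esup> - 1) (e\<^bsup>d w2 t\<^esup> - 1))\<close>,
  which is symmetric in \<open>w1\<close> and \<open>w2\<close>.
\<close>

lemma dirichlet_character_mod:
  assumes "dirichlet_character d \<chi>"
  shows "\<chi> (a mod int d) = \<chi> a"
proof -
  have shift: "\<chi> (b + int k * int d) = \<chi> b" for b k
  proof (induction k)
    case (Suc k)
    have "b + int (Suc k) * int d = (b + int k * int d) + int d"
      by (simp add: algebra_simps)
    with Suc assms show ?case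
      unfolding dirichlet_character_def by metis
  qed simp
  show ?thesis
  proof (cases "a div int d \<ge> 0")
    case True
    then show ?thesis
      using shift[of "a mod int d" "nat (a div int d)"] by (simp add: algebra_simps)
  next
    case False
    \<comment> \<open>\<open>shift\<close> only adds nonnegative multiples of \<open>d\<close>, so
      for a negative quotient it starts from \<open>a\<close> and climbs to the residue.\<close>
    have "a + (- (a div int d)) * int d = a mod int d"
      by (simp add: minus_div_mult_eq_mod)
    with False show ?thesis
      using shift[of a "nat (- (a div int d))"] by simp
  qed
qed

text \<open>Multiplication by the unit \<open>b\<close> permutes the residues modulo
  \<open>d\<close>, so the sum equals \<open>\<chi> b\<close> times itself.\<close>

lemma sum_dirichlet_character_eq_0:
  assumes \<chi>: "dirichlet_character d \<chi>" and b: "coprime b (int d)" "\<chi> b \<noteq> 1"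
  shows "(\<Sum>a<d. \<chi> (int a)) = 0"
proof -
  have d: "d > 0" using \<chi> by (simp add: dirichlet_character_def)
  define g where "g a = b * a mod int d" for a
  have inj: "inj_on g {0..<int d}"
  proof (rule inj_onI)
    fix u v assume uv: "u \<in> {0..<int d}" "v \<in> {0..<int d}" "g u = g v"
    then have "[b * u = b * v] (mod int d)" by (simp add: g_def cong_def)
    then have "[u = v] (mod int d)" using b(1) by (simp add: cong_mult_lcancel)
    then show "u = v" using uv by (simp add: cong_def)
  qed
  have "g ` {0..<int d} \<subseteq> {0..<int d}" using d by (auto simp: g_def)
  with inj have "bij_betw g {0..<int d} {0..<int d}"
    by (simp add: bij_betw_def endo_inj_surj)
  then have "(\<Sum>a\<in>{0..<int d}. \<chi> a) = (\<Sum>a\<in>{0..<int d}. \<chi> (g a))"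
    by (simp add: sum.reindex_bij_betw)
  also have "\<dots> = (\<Sum>a\<in>{0..<int d}. \<chi> b * \<chi> a)"
    using \<chi> by (simp add: g_def dirichlet_character_mod) (simp add: dirichlet_character_def)
  finally have "(\<Sum>a\<in>{0..<int d}. \<chi> a) = 0"
    using b(2) by (simp flip: sum_distrib_left)
  moreover have "(\<Sum>a<d. \<chi> (int a)) = (\<Sum>a\<in>{0..<int d}. \<chi> a)"
    by (rule sum.reindex_bij_witness[of _ nat int]) auto
  ultimately show ?thesis by simp
qed

text \<open>All integers are congruent modulo 1, so if \<open>\<chi>\<close> were 1 on every unit, 1
  would be an induced modulus and the conductor would be at most 1.\<close>

lemma sum_primitive_dirichlet_character:
  assumes "primitive_dirichlet_character d \<chi>" "d > 1"
  shows "(\<Sum>a<d. \<chi> (int a)) = 0"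
proof -
  have \<chi>: "dirichlet_character d \<chi>" and cond: "conductor d \<chi> = d"
    using assms(1) by (auto simp: primitive_dirichlet_character_def)
  have "\<not> induced_modulus d \<chi> 1"
    using cond assms(2) Least_le[of "induced_modulus d \<chi>" 1] by (auto simp: conductor_def)
  then obtain b where "coprime b (int d)" "\<chi> b \<noteq> 1"
    by (auto simp: induced_modulus_def)
  with \<chi> show ?thesis by (rule sum_dirichlet_character_eq_0)
qed

text \<open>An even \<open>a\<close> shares the factor 2 with \<open>d\<close>, which kills the
  character; for odd \<open>a\<close> the exponent is even. The exponent -1 at \<open>a = 0\<close>
  falls under the first case.\<close>

lemma dirichlet_character_even_sign:
  assumes "dirichlet_character d \<chi>" "even d"
  shows "(- 1) powi (int a - 1) * \<chi> (int a) = \<chi> (int a)"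
proof (cases "even a")
  case True
  then have "\<not> coprime (int a) (int d)"
    using assms(2) coprime_common_divisor[of "int a" "int d" 2] by auto
  then show ?thesis using assms(1) by (simp add: dirichlet_character_def)
next
  case False
  then show ?thesis by (simp add: power_int_minus_one_minus)
qed

lemma bernoulli_poly_0: "bernoulli_poly 0 x = 1"
  \<comment> \<open>Since e^t - 1 starts with t, the coefficient of t isolates B_0.\<close>
  using arg_cong[OF bernoulli_poly_egf[of x], of "\<lambda>f. fps_nth f 1"]
  by (simp add: fps_mult_nth)

text \<open>This supplies the generating function of the inner Bernoulli sums, whose index
  \<open>i + 1\<close> comes from dividing by t. The denominator stays on the left as a factor,
  which avoids quotients of series.\<close>

lemma bernoulli_poly_sum_egf:
  fixes f y :: "'a \<Rightarrow> complex"
  assumes "sum f A = 0"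
  shows "Abs_fps (\<lambda>i. c ^ i / fact (i + 1) * (\<Sum>a\<in>A. f a * bernoulli_poly (i + 1) (y a)))
           * (fps_exp c - 1) = (\<Sum>a\<in>A. fps_const (f a) * fps_exp (c * y a))"
proof -
  define G where "G a = Abs_fps (\<lambda>n. bernoulli_poly n (y a) / fact n)" for a
  define H where
    "H = Abs_fps (\<lambda>i. (\<Sum>a\<in>A. f a * bernoulli_poly (i + 1) (y a)) / fact (i + 1))"
  \<comment> \<open>As B_0 = 1, the constant coefficient is \<open>sum f A\<close>, which vanishes;
    hence a factor t splits off.\<close>
  have GH: "(\<Sum>a\<in>A. fps_const (f a) * G a) = fps_X * H"
  proof (rule fps_ext)
    fix n
    show "fps_nth (\<Sum>a\<in>A. fps_const (f a) * G a) n = fps_nth (fps_X * H) n"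
      using assms
      by (cases n) (auto simp: G_def H_def fps_sum_nth bernoulli_poly_0 sum_divide_distrib
          simp del: fact_Suc)
  qed
  have "fps_X * (H * (fps_exp 1 - 1)) = (\<Sum>a\<in>A. fps_const (f a) * (G a * (fps_exp 1 - 1)))"
    unfolding mult.assoc[symmetric] GH[symmetric] sum_distrib_right ..
  also have "\<dots> = fps_X * (\<Sum>a\<in>A. fps_const (f a) * fps_exp (y a))"
    by (simp add: G_def bernoulli_poly_egf sum_distrib_left mult.left_commute)
  finally have H: "H * (fps_exp 1 - 1) = (\<Sum>a\<in>A. fps_const (f a) * fps_exp (y a))"
    by simp
  \<comment> \<open>Substituting \<open>c\<close> t for t turns e^t into e^(ct) and scales
    coefficient \<open>i\<close> by \<open>c ^ i\<close>.\<close>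
  let ?c = "fps_const c * fps_X :: complex fps"
  have "(H oo ?c) * (fps_exp c - 1) = (H * (fps_exp 1 - 1)) oo ?c"
    by (simp add: fps_compose_mult_distrib fps_compose_sub_distrib fps_exp_compose_linear)
  also have "\<dots> = (\<Sum>a\<in>A. fps_const (f a) * fps_exp (c * y a))"
    by (simp add: H fps_compose_sum_distrib fps_compose_mult_distrib fps_exp_compose_linear)
  also have "H oo ?c =
      Abs_fps (\<lambda>i. c ^ i / fact (i + 1) * (\<Sum>a\<in>A. f a * bernoulli_poly (i + 1) (y a)))"
    by (rule fps_ext) (simp add: H_def fps_nth_compose_linear)
  finally show ?thesis .
qed

text \<open>The range splits into \<open>n\<close> blocks of length \<open>d\<close>; by periodicity
  block k is the first block times e^(k d w t). This is a finite geometric sum with its denominator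
  cleared.\<close>

lemma periodic_fps_exp_sum:
  fixes f :: "nat \<Rightarrow> complex"
  assumes "\<And>a. f (a + d) = f a"
  shows "(\<Sum>l<d * n. fps_const (f l) * fps_exp (of_nat l * w)) * (fps_exp (of_nat d * w) - 1)
       = (\<Sum>a<d. fps_const (f a) * fps_exp (of_nat a * w)) * (fps_exp (of_nat (d * n) * w) - 1)"
proof -
  define P where "P = (\<Sum>a<d. fps_const (f a) * fps_exp (of_nat a * w))"
  have f: "f (a + d * k) = f a" for a k
  proof (induction k)
    case (Suc k)
    then show ?case using assms[of "a + d * k"] by (simp add: algebra_simps)
  qed simp
  show ?thesis unfolding P_def[symmetric]
  proof (induction n)
    case (Suc n)
    have "(\<Sum>l<d * Suc n. fps_const (f l) * fps_exp (of_nat l * w))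
        = (\<Sum>l<d * n. fps_const (f l) * fps_exp (of_nat l * w))
          + (\<Sum>l=d * n..<d * n + d. fps_const (f l) * fps_exp (of_nat l * w))"
      unfolding lessThan_atLeast0
      by (subst sum.atLeastLessThan_concat) (simp_all add: algebra_simps)
    also have "(\<Sum>l=d * n..<d * n + d. fps_const (f l) * fps_exp (of_nat l * w))
        = (\<Sum>a<d. fps_const (f (a + d * n)) * fps_exp (of_nat (a + d * n) * w))"
      using sum.shift_bounds_nat_ivl[of "\<lambda>l. fps_const (f l) * fps_exp (of_nat l * w)" 0 "d * n" d]
      by (simp add: lessThan_atLeast0 add.commute)
    also have "\<dots> = P * fps_exp (of_nat (d * n) * w)"
      unfolding f P_def sum_distrib_right
      by (simp add: distrib_right fps_exp_add_mult mult.assoc)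
    finally have split: "(\<Sum>l<d * Suc n. fps_const (f l) * fps_exp (of_nat l * w))
        = (\<Sum>l<d * n. fps_const (f l) * fps_exp (of_nat l * w)) + P * fps_exp (of_nat (d * n) * w)" .
    have "fps_exp (of_nat (d * Suc n) * w) = fps_exp (of_nat (d * n) * w) * fps_exp (of_nat d * w)"
      by (simp add: distrib_left distrib_right mult.commute flip: fps_exp_add_mult)
    with Suc show ?case
      unfolding split by (simp add: algebra_simps)
  qed simp
qed

theorem theorem5:
  fixes d w1 w2 m :: nat and \<chi> :: "int \<Rightarrow> complex" and x :: complex
  assumes "d > 0" and "[d = 0] (mod 2)"
    and "primitive_dirichlet_character d \<chi>"
    and "w1 > 0" and "w2 > 0"
  shows
    "(\<Sum>i = 0..m. of_nat (m choose i) * (of_nat d ^ i / of_nat (i + 1)) *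
        (\<Sum>a = 0..d - 1. (- 1) powi (int a - 1) * \<chi> (int a) *
           bernoulli_poly (i + 1) ((of_nat a + of_nat w2 * x) / of_nat d)) *
        alt_char_power_sum (m - i) \<chi> (d * w1 - 1) * of_nat w1 ^ i * of_nat w2 ^ (m - i))
   = (\<Sum>i = 0..m. of_nat (m choose i) * (of_nat d ^ i / of_nat (i + 1)) *
        (\<Sum>a = 0..d - 1. (- 1) powi (int a - 1) * \<chi> (int a) *
           bernoulli_poly (i + 1) ((of_nat a + of_nat w1 * x) / of_nat d)) *
        alt_char_power_sum (m - i) \<chi> (d * w2 - 1) * of_nat w2 ^ i * of_nat w1 ^ (m - i))"
proof -
  have \<chi>: "dirichlet_character d \<chi>"
    using assms(3) by (simp add: primitive_dirichlet_character_def)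
  have "even d" using assms(2) by (simp add: cong_0_iff)
  with assms(1) have d: "d > 1" by (cases "d = 1") auto
  note sign = dirichlet_character_even_sign[OF \<chi> \<open>even d\<close>]
  have periodic: "\<chi> (int (a + d)) = \<chi> (int a)" for a
    using \<chi> by (simp add: dirichlet_character_def)
  \<comment> \<open>Positivity of \<open>d * w\<close> makes the truncated subtraction a true
    predecessor.\<close>
  have range: "{0..d * w - 1} = {..<d * w}" if "w > 0" for w
  proof -
    from that assms(1) obtain k where "d * w = Suc k"
      by (cases "d * w") auto
    then show ?thesis by (auto simp: less_Suc_eq_le)
  qed
  have range_d: "{0..d - 1} = {..<d}"
    using range[of 1] by simp
  define y :: "nat \<Rightarrow> nat \<Rightarrow> complex" where "y w a = (of_nat a + of_nat w * x) / of_nat d" for w a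
  define P where "P w = (\<Sum>a<d. fps_const (\<chi> (int a)) * fps_exp (of_nat a * of_nat w))" for w :: nat
  define F where "F u v = Abs_fps (\<lambda>i. (of_nat d * of_nat u) ^ i / fact (i + 1) *
      (\<Sum>a<d. \<chi> (int a) * bernoulli_poly (i + 1) (y v a)))" for u v :: nat
  \<comment> \<open>\<open>Q u v\<close> is the exponential generating function of the power sums up
    to \<open>d * u - 1\<close>, taken at \<open>v\<close> t.\<close>
  define Q where "Q u v = (\<Sum>l<d * u. fps_const (\<chi> (int l)) * fps_exp (of_nat l * of_nat v))"
    for u v :: nat
  define D where "D w = fps_exp (of_nat d * of_nat w) - (1 :: complex fps)" for w :: nat
  define S where "S u v = (\<Sum>i = 0..m. of_nat (m choose i) * (of_nat d ^ i / of_nat (i + 1)) *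
        (\<Sum>a = 0..d - 1. (- 1) powi (int a - 1) * \<chi> (int a) *
           bernoulli_poly (i + 1) ((of_nat a + of_nat v * x) / of_nat d)) *
        alt_char_power_sum (m - i) \<chi> (d * u - 1) * of_nat u ^ i * of_nat v ^ (m - i))" for u v :: nat

  have F: "F u v * D u = fps_exp (of_nat u * of_nat v * x) * P u" for u v
  proof -
    \<comment> \<open>The scaling by \<open>d * u\<close> cancels the denominator in
      \<open>y\<close> and isolates a term symmetric in \<open>u\<close> and
      \<open>v\<close>.\<close>
    have dy: "of_nat d * of_nat u * y v a = of_nat u * of_nat v * x + of_nat a * of_nat u" for a
      using d by (simp add: y_def divide_simps) (simp add: algebra_simps)
    have "F u v * D u = (\<Sum>a<d. fps_const (\<chi> (int a)) * fps_exp (of_nat d * of_nat u * y v a))"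
      unfolding F_def D_def
      by (rule bernoulli_poly_sum_egf[OF sum_primitive_dirichlet_character[OF assms(3) d]])
    also have "\<dots> = (\<Sum>a<d. fps_const (\<chi> (int a)) *
        fps_exp (of_nat u * of_nat v * x + of_nat a * of_nat u))"
      by (simp only: dy)
    also have "\<dots> = fps_exp (of_nat u * of_nat v * x) * P u"
      by (simp add: P_def sum_distrib_left fps_exp_add_mult mult.left_commute)
    finally show ?thesis .
  qed
  have Q: "Q u v * D v = P v * (fps_exp (of_nat d * of_nat u * of_nat v) - 1)" for u v
    using periodic_fps_exp_sum[of "\<lambda>l. \<chi> (int l)" d "of_nat v" u, OF periodic]
    by (simp add: Q_def D_def P_def)
  \<comment> \<open>The coefficient of t is \<open>d * w\<close>.\<close>
  have D_nz: "D w \<noteq> 0" if "w > 0" for w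
  proof
    assume "D w = 0"
    then have "fps_nth (D w) 1 = 0" by simp
    with that d show False by (simp add: D_def)
  qed

  have S: "S u v = fact m * fps_nth (F u v * Q u v) m" if "u > 0" for u v
  proof -
    have Q_nth: "fps_nth (Q u v) k = alt_char_power_sum k \<chi> (d * u - 1) * of_nat v ^ k / fact k" for k
      unfolding alt_char_power_sum_def sign range[OF that]
      by (simp add: Q_def fps_sum_nth sum_distrib_right sum_divide_distrib power_mult_distrib mult.assoc)
    show ?thesis
      unfolding S_def fps_mult_nth sum_distrib_left[of "fact m"]
    proof (rule sum.cong[OF refl])
      fix i assume "i \<in> {0..m}"
      \<comment> \<open>The factor 1/i! joins 1/(i+1) to form the 1/(i+1)! of \<open>F\<close>, and
        1/(m-i)! belongs to \<open>Q\<close>.\<close>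
      then have "of_nat (m choose i) = fact m / (fact i * fact (m - i) :: complex)"
        by (simp add: binomial_fact)
      then show "of_nat (m choose i) * (of_nat d ^ i / of_nat (i + 1)) *
          (\<Sum>a = 0..d - 1. (- 1) powi (int a - 1) * \<chi> (int a) *
             bernoulli_poly (i + 1) ((of_nat a + of_nat v * x) / of_nat d)) *
          alt_char_power_sum (m - i) \<chi> (d * u - 1) * of_nat u ^ i * of_nat v ^ (m - i)
        = fact m * (fps_nth (F u v) i * fps_nth (Q u v) (m - i))"
        unfolding sign range_d Q_nth
        by (simp add: F_def y_def power_mult_distrib mult_ac)
    qed
  qed

  \<comment> \<open>Both products are compared after multiplication by the symmetric nonzero series
    \<open>D w1 * D w2\<close>, which is then cancelled.\<close>
  have "(F w1 w2 * Q w1 w2) * (D w1 * D w2) = (F w1 w2 * D w1) * (Q w1 w2 * D w2)"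
    by (simp only: mult_ac)
  also have "\<dots> = (F w2 w1 * D w2) * (Q w2 w1 * D w1)"
    unfolding F Q by (simp only: mult_ac)
  also have "\<dots> = (F w2 w1 * Q w2 w1) * (D w1 * D w2)"
    by (simp only: mult_ac)
  finally have "F w1 w2 * Q w1 w2 = F w2 w1 * Q w2 w1"
    using D_nz assms(4,5) by simp
  then have "S w1 w2 = S w2 w1"
    using S assms(4,5) by simp
  then show ?thesis unfolding S_def .
qed

end
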